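(* Let $X$ be a locally compact Hausdorff space and let $J$ be a norm-closed ideal in $C_0(X)$. Then: (a) $J$ is a band in $C_0(X)$ if and only if $J=J_F^0(X)$ for some closed set $F\subseteq X$ with $F=\overline{\operatorname{Int} F}$ (interior and closure in $X$). (b) $J$ is a projection band in $C_0(X)$ if and only if $J=J_F^0(X)$ for some clopen set $F\subseteq X$.
   Context: $C_0(X)$ is the Banach lattice of continuous real-valued functions on $X$ vanishing at infinity, with the supremum norm and pointwise order. Ideal means order ideal: a linear subspace $Y$ of a vector lattice $E$ such that $0\le |x|\le |y|$ with $x\in E$, $y\in Y$ implies $x\in Y$ (for norm-closed subspaces of $C_0(X)$ order ideals and algebra ideals are the same). A band $B$ in a vector lattice $E$ is an order ideal such that whenever $(x_\alpha)$ is a net in $B$ with $0\le x_\alpha\nearrow x$ in $E$ (i.e. the net is increasing with supremum $x$ in $E$), then $x\in B$. The disjoint complement of $B$ is $B^d=\{x\in E: |x|\wedge |b|=0\text{ for all } b\in B\}$; a band $B$ is a projection band if $E=B\oplus B^d$. For $F\subseteq X$, $J_F^0(X)=\{f\in C_0(X): f|_F\equiv 0\}$. *)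

theory Defs
  imports "HOL-Analysis.Analysis"
begin

section \<open>The space $C_0(X)$\<close>

text \<open>A function on X is represented by a total function that is zero off \<^term>\<open>topspace X\<close>.
  This representation is unique, and the order \<^term>\<open>(\<le>)\<close> on functions then is the
  pointwise order on X.\<close>

definition C0 :: "'a topology \<Rightarrow> ('a \<Rightarrow> real) set" where
  "C0 X = {f. continuous_map X euclideanreal f
            \<and> (\<forall>e>0. \<exists>K. compactin X K \<and> (\<forall>t \<in> topspace X - K. \<bar>f t\<bar> < e))
            \<and> (\<forall>t. t \<notin> topspace X \<longrightarrow> f t = 0)}"

text \<open>The supremum is taken over the whole type, where elements of \<^term>\<open>C0 X\<close> are zero
  off \<^term>\<open>topspace X\<close>; so it is the supremum over X (and 0 if X is empty).\<close>

definition sup_norm :: "('a \<Rightarrow> real) \<Rightarrow> real" where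
  "sup_norm f = (SUP t. \<bar>f t\<bar>)"

text \<open>The locale \<^locale>\<open>Metric_space\<close> wants symmetry and nonnegativity also off the carrier;
  hence the case distinction.\<close>

definition C0_dist :: "'a topology \<Rightarrow> ('a \<Rightarrow> real) \<Rightarrow> ('a \<Rightarrow> real) \<Rightarrow> real" where
  "C0_dist X f g = (if f \<in> C0 X \<and> g \<in> C0 X then sup_norm (\<lambda>t. f t - g t) else 0)"

definition norm_closed_C0 :: "'a topology \<Rightarrow> ('a \<Rightarrow> real) set \<Rightarrow> bool" where
  "norm_closed_C0 X J \<longleftrightarrow> closedin (Metric_space.mtopology (C0 X) (C0_dist X)) J"

definition J0 :: "'a topology \<Rightarrow> 'a set \<Rightarrow> ('a \<Rightarrow> real) set" where
  "J0 X F = {f \<in> C0 X. \<forall>t\<in>F. f t = 0}"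


section \<open>Ideals, bands and projection bands\<close>

text \<open>Here E is a vector lattice of real functions that is closed under the pointwise
  lattice operations (see \<open>C0_is_lub_max\<close> and the lemmas around it for \<^term>\<open>C0 X\<close>).
  Suprema of infinite families are those of the ordered set E; they need not be pointwise.\<close>

definition is_lub_in :: "('a \<Rightarrow> real) set \<Rightarrow> ('a \<Rightarrow> real) set \<Rightarrow> ('a \<Rightarrow> real) \<Rightarrow> bool" where
  "is_lub_in E A s \<longleftrightarrow> s \<in> E \<and> (\<forall>f\<in>A. f \<le> s) \<and> (\<forall>u\<in>E. (\<forall>f\<in>A. f \<le> u) \<longrightarrow> s \<le> u)"

definition is_glb_in :: "('a \<Rightarrow> real) set \<Rightarrow> ('a \<Rightarrow> real) set \<Rightarrow> ('a \<Rightarrow> real) \<Rightarrow> bool" where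
  "is_glb_in E A s \<longleftrightarrow> s \<in> E \<and> (\<forall>f\<in>A. s \<le> f) \<and> (\<forall>u\<in>E. (\<forall>f\<in>A. u \<le> f) \<longrightarrow> u \<le> s)"

definition linear_subspace_of :: "('a \<Rightarrow> real) set \<Rightarrow> ('a \<Rightarrow> real) set \<Rightarrow> bool" where
  "linear_subspace_of E Y \<longleftrightarrow> Y \<subseteq> E \<and> (\<lambda>t. 0) \<in> Y
     \<and> (\<forall>f\<in>Y. \<forall>g\<in>Y. (\<lambda>t. f t + g t) \<in> Y)
     \<and> (\<forall>c. \<forall>f\<in>Y. (\<lambda>t. c * f t) \<in> Y)"

definition order_ideal :: "('a \<Rightarrow> real) set \<Rightarrow> ('a \<Rightarrow> real) set \<Rightarrow> bool" where
  "order_ideal E Y \<longleftrightarrow> linear_subspace_of E Y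
     \<and> (\<forall>f\<in>E. \<forall>g\<in>Y. (\<lambda>t. \<bar>f t\<bar>) \<le> (\<lambda>t. \<bar>g t\<bar>) \<longrightarrow> f \<in> Y)"

definition directed_index :: "'i set \<Rightarrow> 'i rel \<Rightarrow> bool" where
  "directed_index I R \<longleftrightarrow> I \<noteq> {} \<and> R \<subseteq> I \<times> I \<and> refl_on I R \<and> trans R
     \<and> (\<forall>a\<in>I. \<forall>b\<in>I. \<exists>c\<in>I. (a, c) \<in> R \<and> (b, c) \<in> R)"

definition net_increases_to ::
  "('a \<Rightarrow> real) set \<Rightarrow> 'i set \<Rightarrow> 'i rel \<Rightarrow> ('i \<Rightarrow> 'a \<Rightarrow> real) \<Rightarrow> ('a \<Rightarrow> real) \<Rightarrow> bool" where
  "net_increases_to E I R x s \<longleftrightarrow> directed_index I R \<and> x ` I \<subseteq> E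
     \<and> (\<forall>a\<in>I. \<forall>b\<in>I. (a, b) \<in> R \<longrightarrow> x a \<le> x b) \<and> is_lub_in E (x ` I) s"

text \<open>A definition cannot quantify over the type of indices. Index sets in the type of
  functions suffice, because an increasing net can be re-indexed by its range; the lemma
  \<open>band_net\<close> gives the closure property for every index type.\<close>

definition band :: "('a \<Rightarrow> real) set \<Rightarrow> ('a \<Rightarrow> real) set \<Rightarrow> bool" where
  "band E B \<longleftrightarrow> order_ideal E B
     \<and> (\<forall>(I :: ('a \<Rightarrow> real) set) R x s.
          x ` I \<subseteq> B \<and> (\<forall>a\<in>I. (\<lambda>t. 0) \<le> x a) \<and> net_increases_to E I R x s \<longrightarrow> s \<in> B)"

definition disjoint_complement :: "('a \<Rightarrow> real) set \<Rightarrow> ('a \<Rightarrow> real) set \<Rightarrow> ('a \<Rightarrow> real) set" where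
  "disjoint_complement E B = {f \<in> E. \<forall>b\<in>B. (\<lambda>t. min \<bar>f t\<bar> \<bar>b t\<bar>) = (\<lambda>t. 0)}"

definition projection_band :: "('a \<Rightarrow> real) set \<Rightarrow> ('a \<Rightarrow> real) set \<Rightarrow> bool" where
  "projection_band E B \<longleftrightarrow> band E B
     \<and> E = {(\<lambda>t. g t + h t) | g h. g \<in> B \<and> h \<in> disjoint_complement E B}
     \<and> B \<inter> disjoint_complement E B = {\<lambda>t. 0}"

lemma band_net:
  fixes I :: "'i set" and x :: "'i \<Rightarrow> 'a \<Rightarrow> real"
  assumes "band E B" "x ` I \<subseteq> B" "\<forall>a\<in>I. (\<lambda>t. 0) \<le> x a" "net_increases_to E I R x s"
  shows "s \<in> B"
proof -
  let ?D = "x ` I" and ?R = "{(f, g). f \<in> x ` I \<and> g \<in> x ` I \<and> f \<le> g}"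
  have I: "directed_index I R"
    and mono: "\<And>a b. a \<in> I \<Longrightarrow> b \<in> I \<Longrightarrow> (a, b) \<in> R \<Longrightarrow> x a \<le> x b"
    using assms(4) by (auto simp: net_increases_to_def)
  have dir: "\<exists>h\<in>?D. (f, h) \<in> ?R \<and> (g, h) \<in> ?R" if fg: "f \<in> ?D" "g \<in> ?D" for f g
  proof -
    obtain a b where ab: "a \<in> I" "b \<in> I" "f = x a" "g = x b"
      using fg by blast
    then obtain c where "c \<in> I" "(a, c) \<in> R" "(b, c) \<in> R"
      using I unfolding directed_index_def by blast
    then show ?thesis using ab mono by blast
  qed
  have "?D \<noteq> {}" using I by (auto simp: directed_index_def)
  moreover have "?R \<subseteq> ?D \<times> ?D" "refl_on ?D ?R" by (auto simp: refl_on_def)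
  moreover have "trans ?R" by (auto simp: trans_def)
  ultimately have "directed_index ?D ?R"
    unfolding directed_index_def using dir by blast
  then have "net_increases_to E ?D ?R (\<lambda>f. f) s"
    using assms(4) by (simp add: net_increases_to_def)
  moreover have "(\<lambda>f. f) ` ?D \<subseteq> B \<and> (\<forall>f\<in>?D. (\<lambda>t. 0) \<le> f)"
    using assms(2,3) by auto
  ultimately show ?thesis
    using assms(1)[unfolded band_def, THEN conjunct2, rule_format, of "\<lambda>f. f" ?D ?R s] by simp
qed


section \<open>$C_0(X)$ is a normed vector lattice with pointwise operations\<close>

lemma C0_bounded:
  assumes "f \<in> C0 X" shows "bdd_above (range (\<lambda>t. \<bar>f t\<bar>))"
proof -
  obtain K where K: "compactin X K" "\<And>t. t \<in> topspace X - K \<Longrightarrow> \<bar>f t\<bar> < 1"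
    using assms zero_less_one unfolding C0_def by blast
  have "continuous_map X euclideanreal f" using assms by (simp add: C0_def)
  then have "compact (f ` K)" using image_compactin[OF K(1)] by (metis compactin_euclidean_iff)
  then obtain M where M: "\<And>t. t \<in> K \<Longrightarrow> \<bar>f t\<bar> \<le> M"
    using compact_imp_bounded[of "f ` K"] unfolding bounded_real by blast
  have "f t = 0" if "t \<notin> topspace X" for t using assms that by (simp add: C0_def)
  then have "\<bar>f t\<bar> \<le> max 1 M" for t
    using K(2)[of t] M[of t] by (cases "t \<in> topspace X"; cases "t \<in> K") (auto simp: le_max_iff_disj)
  then show ?thesis by (rule bdd_aboveI2)
qed

lemma C0_zero: "(\<lambda>t. 0) \<in> C0 X"
  unfolding C0_def by (auto intro: exI[of _ "{}"])

lemma C0_combine: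
  assumes f: "f \<in> C0 X" and g: "g \<in> C0 X"
    and cont: "continuous_map X euclideanreal (\<lambda>t. p (f t) (g t))"
    and bound: "\<And>a b. \<bar>p a b\<bar> \<le> c * (\<bar>a\<bar> + \<bar>b\<bar>)" and c: "c > 0"
  shows "(\<lambda>t. p (f t) (g t)) \<in> C0 X"
proof -
  have "\<exists>K. compactin X K \<and> (\<forall>t \<in> topspace X - K. \<bar>p (f t) (g t)\<bar> < e)" if e: "e > 0" for e
  proof -
    have e': "e / (2 * c) > 0" using e c by simp
    obtain K where K: "compactin X K" "\<And>t. t \<in> topspace X - K \<Longrightarrow> \<bar>f t\<bar> < e / (2 * c)"
      using f e' unfolding C0_def by blast
    obtain L where L: "compactin X L" "\<And>t. t \<in> topspace X - L \<Longrightarrow> \<bar>g t\<bar> < e / (2 * c)"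
      using g e' unfolding C0_def by blast
    have "\<bar>p (f t) (g t)\<bar> < e" if "t \<in> topspace X - (K \<union> L)" for t
    proof -
      have "\<bar>f t\<bar> + \<bar>g t\<bar> < e / (2 * c) + e / (2 * c)"
        using K(2) L(2) that by (intro add_strict_mono) auto
      also have "\<dots> = e / c" by (simp add: field_simps)
      finally have "c * (\<bar>f t\<bar> + \<bar>g t\<bar>) < e" using c by (simp add: field_simps)
      then show ?thesis using bound[of "f t" "g t"] by linarith
    qed
    then show ?thesis using compactin_Un[OF K(1) L(1)] by blast
  qed
  moreover have "p (f t) (g t) = 0" if "t \<notin> topspace X" for t
    using that f g bound[of "f t" "g t"] by (simp add: C0_def)
  ultimately show ?thesis using cont by (simp add: C0_def)
qed

lemma C0_continuous: "f \<in> C0 X \<Longrightarrow> continuous_map X euclideanreal f"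
  by (simp add: C0_def)

lemma C0_add:
  assumes "f \<in> C0 X" "g \<in> C0 X" shows "(\<lambda>t. f t + g t) \<in> C0 X"
proof (rule C0_combine[OF assms, of "\<lambda>a b. a + b" 1])
  show "continuous_map X euclideanreal (\<lambda>t. f t + g t)"
    using assms by (intro continuous_map_add C0_continuous)
qed auto

lemma C0_diff:
  assumes "f \<in> C0 X" "g \<in> C0 X" shows "(\<lambda>t. f t - g t) \<in> C0 X"
proof (rule C0_combine[OF assms, of "\<lambda>a b. a - b" 1])
  show "continuous_map X euclideanreal (\<lambda>t. f t - g t)"
    using assms by (intro continuous_map_diff C0_continuous)
qed auto

lemma C0_scale:
  assumes "f \<in> C0 X" shows "(\<lambda>t. c * f t) \<in> C0 X"
proof (rule C0_combine[OF assms assms, of "\<lambda>a b. c * a" "\<bar>c\<bar> + 1"])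
  show "continuous_map X euclideanreal (\<lambda>t. c * f t)"
    using assms by (intro continuous_map_real_mult_left C0_continuous)
  show "\<bar>c * a\<bar> \<le> (\<bar>c\<bar> + 1) * (\<bar>a\<bar> + \<bar>b\<bar>)" for a b
    unfolding abs_mult by (intro mult_mono) auto
qed auto

lemma C0_max:
  assumes "f \<in> C0 X" "g \<in> C0 X" shows "(\<lambda>t. max (f t) (g t)) \<in> C0 X"
proof (rule C0_combine[OF assms, of "\<lambda>a b. max a b" 1])
  show "continuous_map X euclideanreal (\<lambda>t. max (f t) (g t))"
    using assms by (intro continuous_map_real_max C0_continuous)
qed auto

lemma C0_min:
  assumes "f \<in> C0 X" "g \<in> C0 X" shows "(\<lambda>t. min (f t) (g t)) \<in> C0 X"
proof (rule C0_combine[OF assms, of "\<lambda>a b. min a b" 1])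
  show "continuous_map X euclideanreal (\<lambda>t. min (f t) (g t))"
    using assms by (intro continuous_map_real_min C0_continuous)
qed auto

lemma C0_abs:
  assumes "f \<in> C0 X" shows "(\<lambda>t. \<bar>f t\<bar>) \<in> C0 X"
proof (rule C0_combine[OF assms assms, of "\<lambda>a b. \<bar>a\<bar>" 1])
  show "continuous_map X euclideanreal (\<lambda>t. \<bar>f t\<bar>)"
    using assms by (intro continuous_map_real_abs C0_continuous)
qed auto

lemma C0_is_lub_max:
  "f \<in> C0 X \<Longrightarrow> g \<in> C0 X \<Longrightarrow> is_lub_in (C0 X) {f, g} (\<lambda>t. max (f t) (g t))"
  by (auto simp: is_lub_in_def le_fun_def C0_max)

lemma C0_is_glb_min:
  "f \<in> C0 X \<Longrightarrow> g \<in> C0 X \<Longrightarrow> is_glb_in (C0 X) {f, g} (\<lambda>t. min (f t) (g t))"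
  by (auto simp: is_glb_in_def le_fun_def C0_min)

lemma C0_is_lub_abs:
  "f \<in> C0 X \<Longrightarrow> is_lub_in (C0 X) {f, \<lambda>t. - f t} (\<lambda>t. \<bar>f t\<bar>)"
  by (auto simp: is_lub_in_def le_fun_def C0_abs abs_le_iff)

lemma sup_norm_upper: "f \<in> C0 X \<Longrightarrow> \<bar>f t\<bar> \<le> sup_norm f"
  unfolding sup_norm_def by (rule cSUP_upper[OF _ C0_bounded]) auto

lemma Metric_space_C0: "Metric_space (C0 X) (C0_dist X)"
proof
  show "0 \<le> C0_dist X f g" for f g
  proof (cases "f \<in> C0 X \<and> g \<in> C0 X")
    case True
    then show ?thesis
      using order_trans[OF abs_ge_zero sup_norm_upper[OF C0_diff, of f X g]] by (simp add: C0_dist_def)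
  qed (simp only: C0_dist_def if_False order_refl)
  show "C0_dist X f g = C0_dist X g f" for f g
    by (simp add: C0_dist_def sup_norm_def abs_minus_commute)
  show "C0_dist X f g = 0 \<longleftrightarrow> f = g" if "f \<in> C0 X" "g \<in> C0 X" for f g
  proof
    assume "C0_dist X f g = 0"
    then show "f = g"
      using sup_norm_upper[OF C0_diff[OF that]] that by (auto simp: C0_dist_def fun_eq_iff)
  qed (use that in \<open>simp add: C0_dist_def sup_norm_def\<close>)
  show "C0_dist X f h \<le> C0_dist X f g + C0_dist X g h"
    if "f \<in> C0 X" "g \<in> C0 X" "h \<in> C0 X" for f g h
  proof -
    have "\<bar>f t - h t\<bar> \<le> sup_norm (\<lambda>t. f t - g t) + sup_norm (\<lambda>t. g t - h t)" for t
      using sup_norm_upper[OF C0_diff[OF that(1,2)], of t]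
        sup_norm_upper[OF C0_diff[OF that(2,3)], of t] by linarith
    then show ?thesis
      using that by (auto simp: C0_dist_def sup_norm_def[of "\<lambda>t. f t - h t"] intro: cSUP_least)
  qed
qed

end

theory Submission
  imports Defs
begin

text \<open>A norm-closed ideal J equals \<open>J0 X F\<close> for its common zero set F: given f vanishing on F and
  \<open>e > 0\<close>, compactness of \<open>{\<bar>f\<bar> \<ge> e}\<close> yields \<open>g \<in> J\<close> dominating \<open>\<bar>f\<bar>\<close> there, and f truncated
  to \<open>[-g, g]\<close> lies in J within e of f.

  Urysohn functions show that the functions of J below a positive f that vanishes on the interior
  of F have supremum f in \<^term>\<open>C0 X\<close>. So a band J does not distinguish F from the closure of
  its interior. Conversely, the supremum of a net vanishing on F could be lowered at any interior
  point of F where it is positive, so it vanishes on the interior and hence on its closure.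

  The disjoint complement of \<open>J0 X F\<close> consists of functions that vanish off F; decomposing a
  function that is 1 at a point of F shows that F is a neighbourhood of that point.\<close>

section \<open>Continuous functions with prescribed zeros and compact superlevel sets\<close>

text \<open>Locally compact Hausdorff spaces are completely regular. Separating \<open>x\<close>
  from the complement of \<open>U \<inter> V\<close>, where \<open>V\<close> lies in a compact
  \<open>K\<close>, makes the function vanish off \<open>K\<close> and hence at infinity.\<close>

lemma C0_bump:
  assumes lc: "locally_compact_space X" and H: "Hausdorff_space X"
    and U: "openin X U" "x \<in> U"
  obtains f where "f \<in> C0 X" "f x = 1" "\<And>t. 0 \<le> f t" "\<And>t. t \<notin> U \<Longrightarrow> f t = 0"
proof -
  have xX: "x \<in> topspace X" using U openin_subset by blast
  then obtain V K where VK: "openin X V" "compactin X K" "x \<in> V" "V \<subseteq> K"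
    using lc unfolding locally_compact_space_def by blast
  have "completely_regular_space X"
    using lc H locally_compact_regular_imp_completely_regular_space by blast
  moreover have "openin X (U \<inter> V)" "x \<in> U \<inter> V" using U VK by auto
  ultimately obtain g :: "'a \<Rightarrow> real" where g: "continuous_map X euclidean g" "g x = 1"
      "g ` (topspace X - U \<inter> V) \<subseteq> {0}"
    using completely_regular_space_gen_alt'[of "1::real" 0 X] by (metis zero_neq_one)
  let ?f = "\<lambda>t. if t \<in> topspace X then \<bar>g t\<bar> else 0"
  have zero: "?f t = 0" if "t \<notin> U \<inter> V" for t
    using g(3) that by auto
  have "continuous_map X euclideanreal (\<lambda>t. \<bar>g t\<bar>)"
    using g by (intro continuous_map_real_abs)
  then have "continuous_map X euclideanreal ?f"
    by (rule continuous_map_eq) simp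
  moreover have "\<bar>?f t\<bar> < e" if "e > 0" "t \<in> topspace X - K" for e t
  proof -
    have "?f t = 0" using that(2) VK(4) by (intro zero) blast
    then show ?thesis using that(1) by simp
  qed
  ultimately have "?f \<in> C0 X"
    unfolding C0_def using VK(2) by auto
  moreover have "?f x = 1" using g(2) xX by simp
  ultimately show thesis using that[of ?f] zero by auto
qed

text \<open>A clopen set has empty frontier, so the two pieces need no matching condition for
  continuity.\<close>

lemma C0_restrict_clopen:
  assumes f: "f \<in> C0 X" and A: "closedin X A" "openin X A"
  shows "(\<lambda>t. if t \<in> A then f t else 0) \<in> C0 X"
proof -
  have "X frontier_of A = {}" using A frontier_of_eq_empty closedin_subset by metis
  moreover have "{t \<in> topspace X. t \<in> A} = A" using closedin_subset[OF A(1)] by blast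
  ultimately have "continuous_map X euclideanreal (\<lambda>t. if t \<in> A then f t else 0)"
    using C0_continuous[OF f]
    by (intro continuous_map_cases_alt continuous_map_from_subtopology) auto
  moreover have "\<exists>K. compactin X K \<and> (\<forall>t\<in>topspace X - K. \<bar>if t \<in> A then f t else 0\<bar> < e)"
    if e: "e > 0" for e
  proof -
    obtain K where "compactin X K" "\<forall>t\<in>topspace X - K. \<bar>f t\<bar> < e"
      using f e unfolding C0_def by blast
    then show ?thesis using e by (intro exI[of _ K]) auto
  qed
  ultimately show ?thesis using f by (simp add: C0_def)
qed

lemma compactin_superlevel:
  assumes f: "f \<in> C0 X" and e: "e > 0"
  shows "compactin X {t \<in> topspace X. e \<le> \<bar>f t\<bar>}"
proof -
  obtain K where K: "compactin X K" "\<forall>t\<in>topspace X - K. \<bar>f t\<bar> < e"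
    using f e unfolding C0_def by blast
  have "closedin X {t \<in> topspace X. \<bar>f t\<bar> \<in> {e..}}"
    using C0_continuous[OF C0_abs[OF f]] by (rule closedin_continuous_map_preimage) simp
  then show ?thesis
    using K by (intro closed_compactin[OF K(1)]) (auto simp: not_le[symmetric])
qed

lemma closedin_zeros:
  assumes "J \<subseteq> C0 X"
  shows "closedin X {t \<in> topspace X. \<forall>f\<in>J. f t = 0}"
proof -
  have "openin X {t \<in> topspace X. f t \<in> - {0}}" if "f \<in> J" for f
    using C0_continuous assms that by (intro openin_continuous_map_preimage) auto
  then have "openin X (\<Union>f\<in>J. {t \<in> topspace X. f t \<in> - {0}})" by blast
  moreover have "(\<Union>f\<in>J. {t \<in> topspace X. f t \<in> - {0}})
      = topspace X - {t \<in> topspace X. \<forall>f\<in>J. f t = 0}" by auto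
  ultimately show ?thesis unfolding closedin_def by auto
qed

section \<open>Norm-closed ideals and their zero sets\<close>

lemma order_idealD:
  assumes "order_ideal E J"
  shows "J \<subseteq> E" "(\<lambda>t. 0) \<in> J" "f \<in> J \<Longrightarrow> g \<in> J \<Longrightarrow> (\<lambda>t. f t + g t) \<in> J"
    "f \<in> J \<Longrightarrow> (\<lambda>t. c * f t) \<in> J"
    "f \<in> E \<Longrightarrow> g \<in> J \<Longrightarrow> (\<And>t. \<bar>f t\<bar> \<le> \<bar>g t\<bar>) \<Longrightarrow> f \<in> J"
  using assms unfolding order_ideal_def linear_subspace_of_def le_fun_def by blast+

lemma order_ideal_abs:
  assumes "order_ideal (C0 X) J" "f \<in> J"
  shows "(\<lambda>t. \<bar>f t\<bar>) \<in> J"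
  using assms order_idealD(1)[OF assms(1)] by (intro order_idealD(5)[OF assms(1) _ assms(2)] C0_abs) auto

text \<open>The sum of the absolute values over \<open>A\<close> is such a bound.\<close>

lemma order_ideal_finite_dominated:
  assumes J: "order_ideal (C0 X) J" and "finite A" "A \<subseteq> J"
  shows "\<exists>g\<in>J. (\<forall>t. 0 \<le> g t) \<and> (\<forall>f\<in>A. \<forall>t. \<bar>f t\<bar> \<le> g t)"
  using assms(2,3)
proof (induction A)
  case empty
  then show ?case using order_idealD(2)[OF J] by force
next
  case (insert h A)
  then obtain g where g: "g \<in> J" "\<forall>t. 0 \<le> g t" "\<forall>f\<in>A. \<forall>t. \<bar>f t\<bar> \<le> g t" by auto
  have "(\<lambda>t. \<bar>h t\<bar> + g t) \<in> J"
    using insert.prems g(1) J by (intro order_idealD(3)[OF J] order_ideal_abs) auto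
  then show ?case
    using g(2,3) by (intro bexI[of _ "\<lambda>t. \<bar>h t\<bar> + g t"]) (auto intro: add_increasing)
qed

lemma norm_closed_C0D:
  assumes J: "norm_closed_C0 X J" and f: "f \<in> C0 X"
    and approx: "\<And>e. e > 0 \<Longrightarrow> \<exists>g\<in>J. \<forall>t. \<bar>f t - g t\<bar> \<le> e"
  shows "f \<in> J"
proof (rule ccontr)
  interpret Metric_space "C0 X" "C0_dist X" by (rule Metric_space_C0)
  assume "f \<notin> J"
  then obtain r where r: "r > 0" "disjnt J (mball f r)" and JC: "J \<subseteq> C0 X"
    using J f unfolding norm_closed_C0_def closedin_metric by blast
  \<comment> \<open>Halving the radius keeps the supremum strictly below \<open>r\<close>, as the
    open ball requires.\<close>
  obtain g where g: "g \<in> J" "\<forall>t. \<bar>f t - g t\<bar> \<le> r / 2" using approx[of "r / 2"] r(1) by auto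
  have "C0_dist X f g \<le> r / 2"
    using g f JC
    by (auto simp: C0_dist_def sup_norm_def simp del: le_divide_eq_numeral1 intro!: cSUP_least)
  then have "g \<in> mball f r" using g(1) f JC r(1) by auto
  then show False using r(2) g(1) by (auto simp: disjnt_iff)
qed

lemma norm_closed_ideal_eq_J0:
  assumes J: "order_ideal (C0 X) J" and cl: "norm_closed_C0 X J"
  obtains F where "closedin X F" "J = J0 X F"
proof
  define F where "F = {t \<in> topspace X. \<forall>f\<in>J. f t = 0}"
  note JC = order_idealD(1)[OF J]
  show "closedin X F" unfolding F_def by (rule closedin_zeros[OF JC])
  show "J = J0 X F"
  proof
    show "J \<subseteq> J0 X F" using JC by (auto simp: J0_def F_def)
    show "J0 X F \<subseteq> J"
    proof
      fix f assume "f \<in> J0 X F"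
      then have f: "f \<in> C0 X" "\<And>t. t \<in> F \<Longrightarrow> f t = 0" by (auto simp: J0_def)
      show "f \<in> J"
      proof (rule norm_closed_C0D[OF cl f(1)])
        fix e :: real assume e: "e > 0"
        let ?K = "{t \<in> topspace X. e \<le> \<bar>f t\<bar>}" and ?M = "sup_norm f"
        \<comment> \<open>On \<open>?V g\<close> the function \<open>g\<close> exceeds every value
          of \<bar>f\<bar>.\<close>
        let ?V = "\<lambda>g. {t \<in> topspace X. g t \<in> {?M<..}}"
        have "openin X (?V g)" if "g \<in> J" for g
          using that JC C0_continuous by (intro openin_continuous_map_preimage) auto
        moreover have "?K \<subseteq> \<Union> (?V ` J)"
        proof
          fix t assume t: "t \<in> ?K"
          then have "t \<notin> F" using f(2) e by force
          then obtain g where g: "g \<in> J" "g t \<noteq> 0" using t by (auto simp: F_def)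
          \<comment> \<open>The factor corrects size and sign: the multiple has value
            \<open>?M + 1\<close> at \<open>t\<close>.\<close>
          have "(\<lambda>s. (?M + 1) / g t * g s) \<in> J" by (rule order_idealD(4)[OF J g(1)])
          then show "t \<in> \<Union> (?V ` J)" using g t by (intro UN_I) auto
        qed
        ultimately have "\<exists>\<F>. finite \<F> \<and> \<F> \<subseteq> ?V ` J \<and> ?K \<subseteq> \<Union> \<F>"
          by (intro compactinD[OF compactin_superlevel[OF f(1) e]]) auto
        then obtain \<F> where \<F>: "finite \<F>" "\<F> \<subseteq> ?V ` J" "?K \<subseteq> \<Union> \<F>" by blast
        obtain A where A: "finite A" "A \<subseteq> J" "?K \<subseteq> \<Union> (?V ` A)"
          using finite_subset_image[OF \<F>(1,2)] \<F>(3) by blast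
        then obtain g where g: "g \<in> J" "\<And>t. 0 \<le> g t" "\<And>h t. h \<in> A \<Longrightarrow> \<bar>h t\<bar> \<le> g t"
          using order_ideal_finite_dominated[OF J A(1,2)] by blast
        have gK: "\<bar>f t\<bar> \<le> g t" if t: "t \<in> ?K" for t
        proof -
          obtain h where h: "h \<in> A" "?M < h t" using A(3) t by auto
          then show ?thesis using sup_norm_upper[OF f(1), of t] g(3)[OF h(1), of t] by linarith
        qed
        \<comment> \<open>The truncation of \<open>f\<close> to the interval from \<open>-g\<close>
          to \<open>g\<close> leaves \<open>f\<close> unchanged on \<open>?K\<close>. Elsewhere it
          lies between 0 and \<open>f\<close>, so the error is at most \<bar>f\<bar>, hence at most
          \<open>e\<close>.\<close>
        let ?h = "\<lambda>t. max (min (f t) (g t)) (- 1 * g t)"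
        have gC: "g \<in> C0 X" using g(1) JC by auto
        have "?h \<in> C0 X" by (intro C0_max C0_min C0_scale f(1) gC)
        then have "?h \<in> J"
        proof (rule order_idealD(5)[OF J _ g(1)])
          show "\<bar>?h t\<bar> \<le> \<bar>g t\<bar>" for t using g(2)[of t] by (auto simp: max_def min_def)
        qed
        moreover have "\<bar>f t - ?h t\<bar> \<le> e" for t
        proof (cases "t \<in> ?K")
          case True
          then show ?thesis using gK[OF True] e by (auto simp: max_def min_def)
        next
          case False
          then have "\<bar>f t\<bar> \<le> e" using f(1) e by (auto simp: C0_def)
          then show ?thesis using g(2)[of t] by (auto simp: max_def min_def)
        qed
        ultimately show "\<exists>h\<in>J. \<forall>t. \<bar>f t - h t\<bar> \<le> e"
          by (intro bexI[of _ ?h]) auto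
      qed
    qed
  qed
qed

section \<open>Bands and regular closed sets\<close>

text \<open>A directed set is an increasing net indexed by itself.\<close>

lemma band_directed_set:
  assumes "band E B" "D \<subseteq> B" "D \<subseteq> E" "D \<noteq> {}" "\<And>f. f \<in> D \<Longrightarrow> (\<lambda>t. 0) \<le> f"
    and dir: "\<And>f g. f \<in> D \<Longrightarrow> g \<in> D \<Longrightarrow> \<exists>h\<in>D. f \<le> h \<and> g \<le> h"
    and "is_lub_in E D s"
  shows "s \<in> B"
proof (rule band_net[OF assms(1), of "\<lambda>f. f" D "{(f, g). f \<in> D \<and> g \<in> D \<and> f \<le> g}"])
  have "directed_index D {(f, g). f \<in> D \<and> g \<in> D \<and> f \<le> g}"
    using assms(4) dir unfolding directed_index_def refl_on_def trans_def
    by (auto intro: order_trans)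
  then show "net_increases_to E D {(f, g). f \<in> D \<and> g \<in> D \<and> f \<le> g} (\<lambda>f. f) s"
    using assms(3,7) by (simp add: net_increases_to_def)
qed (use assms in auto)

lemma is_lub_in_J0_below:
  assumes lc: "locally_compact_space X" and H: "Hausdorff_space X"
    and F: "closedin X F" and f: "f \<in> C0 X" "\<And>t. 0 \<le> f t"
    and f0: "\<And>t. t \<in> X interior_of F \<Longrightarrow> f t = 0"
  shows "is_lub_in (C0 X) {g \<in> J0 X F. (\<lambda>t. 0) \<le> g \<and> g \<le> f} f"
  unfolding is_lub_in_def
proof (intro conjI ballI impI)
  fix u assume u: "u \<in> C0 X" and ub: "\<forall>g\<in>{g \<in> J0 X F. (\<lambda>t. 0) \<le> g \<and> g \<le> f}. g \<le> u"
  have "(\<lambda>t. 0) \<in> {g \<in> J0 X F. (\<lambda>t. 0) \<le> g \<and> g \<le> f}"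
    using f(2) C0_zero by (auto simp: J0_def le_fun_def)
  then have u0: "0 \<le> u t" for t using ub by (auto simp: le_fun_def)
  \<comment> \<open>The open set where the upper bound \<open>u\<close> fails to dominate
    \<open>f\<close>; the aim is to show it empty.\<close>
  define W where "W = {t \<in> topspace X. f t - u t \<in> {0<..}}"
  have W: "openin X W" unfolding W_def
    using C0_continuous[OF C0_diff[OF f(1) u]] by (rule openin_continuous_map_preimage) simp
  have "W \<subseteq> F"
  proof (rule ccontr)
    assume "\<not> W \<subseteq> F"
    then obtain s where s: "s \<in> W - F" by blast
    have "openin X (W - F)" using W F by (rule openin_diff)
    then obtain \<phi> where \<phi>: "\<phi> \<in> C0 X" "\<phi> s = 1" "\<And>t. 0 \<le> \<phi> t" "\<And>t. t \<notin> W - F \<Longrightarrow> \<phi> t = 0"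
      using C0_bump[OF lc H _ s] by metis
    \<comment> \<open>This function belongs to the family and has value \<open>f s\<close> at
      \<open>s\<close>, so \<open>u\<close> cannot be smaller there.\<close>
    let ?g = "\<lambda>t. min (f t) (f s * \<phi> t)"
    have "?g \<in> C0 X" by (intro C0_min C0_scale f(1) \<phi>(1))
    then have "?g \<in> J0 X F" using \<phi>(4) f(2) by (auto simp: J0_def)
    then have "?g \<le> u" using ub f(2) \<phi>(3) by (auto simp: le_fun_def)
    then have "f s \<le> u s" using \<phi>(2) by (metis le_fun_def min.idem mult.right_neutral)
    then show False using s by (auto simp: W_def)
  qed
  then have "W \<subseteq> X interior_of F" using W by (rule interior_of_maximal)
  \<comment> \<open>On the interior of \<open>F\<close>, \<open>f\<close> is 0 and \<open>u\<close>
    is nonnegative.\<close>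
  then have "W = {}" using f0 u0 unfolding W_def by (force simp: not_less)
  show "f \<le> u"
    unfolding le_fun_def
  proof
    fix t show "f t \<le> u t"
      using \<open>W = {}\<close> f(1) u by (cases "t \<in> topspace X") (auto simp: W_def C0_def)
  qed
qed (use f in auto)

lemma band_J0_imp_eq:
  assumes lc: "locally_compact_space X" and H: "Hausdorff_space X"
    and F: "closedin X F" and band: "band (C0 X) (J0 X F)"
  shows "J0 X F = J0 X (X closure_of (X interior_of F))"
proof
  have "X closure_of (X interior_of F) \<subseteq> F"
    using closure_of_minimal[OF interior_of_subset F] .
  then show "J0 X F \<subseteq> J0 X (X closure_of (X interior_of F))" by (auto simp: J0_def)
  show "J0 X (X closure_of (X interior_of F)) \<subseteq> J0 X F"
  proof
    fix f assume f: "f \<in> J0 X (X closure_of (X interior_of F))"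
    \<comment> \<open>Passing to \<bar>f\<bar> supplies the required positivity and preserves the
      zeros.\<close>
    let ?a = "\<lambda>t. \<bar>f t\<bar>" and ?D = "{g \<in> J0 X F. (\<lambda>t. 0) \<le> g \<and> g \<le> (\<lambda>t. \<bar>f t\<bar>)}"
    have fC: "f \<in> C0 X" using f by (simp add: J0_def)
    have "X interior_of F \<subseteq> X closure_of (X interior_of F)"
      by (simp add: closure_of_subset interior_of_subset_topspace)
    then have "is_lub_in (C0 X) ?D ?a"
      using f by (intro is_lub_in_J0_below[OF lc H F] C0_abs fC) (auto simp: J0_def)
    moreover have "\<exists>h\<in>?D. g \<le> h \<and> k \<le> h" if "g \<in> ?D" "k \<in> ?D" for g k
      using that by (intro bexI[of _ "\<lambda>t. max (g t) (k t)"])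
        (auto simp: J0_def le_fun_def C0_max intro: le_max_iff_disj[THEN iffD2])
    moreover have "(\<lambda>t. 0) \<in> ?D" using C0_zero by (auto simp: J0_def le_fun_def)
    ultimately have "?a \<in> J0 X F"
      by (intro band_directed_set[OF band, of ?D]) (auto simp: J0_def)
    then show "f \<in> J0 X F" using fC by (simp add: J0_def)
  qed
qed

lemma order_ideal_J0: "order_ideal (C0 X) (J0 X F)"
proof -
  have "f t = 0" if "\<And>r. \<bar>f r\<bar> \<le> \<bar>g r\<bar>" "g t = 0" for f g :: "'a \<Rightarrow> real" and t
    using that(1)[of t] that(2) by simp
  then show ?thesis
    unfolding order_ideal_def linear_subspace_of_def J0_def le_fun_def
    by (auto simp: C0_zero C0_add C0_scale)
qed

lemma band_J0:
  assumes lc: "locally_compact_space X" and H: "Hausdorff_space X"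
    and F: "F = X closure_of (X interior_of F)"
  shows "band (C0 X) (J0 X F)"
  unfolding band_def
proof (intro conjI allI impI order_ideal_J0, elim conjE)
  fix I :: "('a \<Rightarrow> real) set" and R x s
  assume xJ: "x ` I \<subseteq> J0 X F" and x0: "\<forall>a\<in>I. (\<lambda>t. 0) \<le> x a"
    and "net_increases_to (C0 X) I R x s"
  then have s: "s \<in> C0 X" "\<And>a. a \<in> I \<Longrightarrow> x a \<le> s" and "I \<noteq> {}"
    and least: "\<And>u. u \<in> C0 X \<Longrightarrow> (\<And>a. a \<in> I \<Longrightarrow> x a \<le> u) \<Longrightarrow> s \<le> u"
    by (auto simp: net_increases_to_def is_lub_in_def directed_index_def)
  then have s0: "0 \<le> s t" for t using x0 by (force simp: le_fun_def intro: order_trans)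
  have zero: "s t = 0" if t: "t \<in> X interior_of F" for t
  proof -
    obtain \<phi> where \<phi>: "\<phi> \<in> C0 X" "\<phi> t = 1" "\<And>r. 0 \<le> \<phi> r" "\<And>r. r \<notin> X interior_of F \<Longrightarrow> \<phi> r = 0"
      using C0_bump[OF lc H openin_interior_of t] by metis
    \<comment> \<open>Lowers \<open>s\<close> only inside the interior of \<open>F\<close>, where
      every \<open>x a\<close> is 0; the minimum keeps \<open>?u\<close> nonnegative. So
      \<open>?u\<close> is still an upper bound, yet its value at \<open>t\<close> is 0.\<close>
    let ?u = "\<lambda>r. s r - min (s r) (s t * \<phi> r)"
    have "s \<le> ?u"
    proof (rule least)
      show "?u \<in> C0 X" by (intro C0_diff C0_min C0_scale s(1) \<phi>(1))
      show "x a \<le> ?u" if a: "a \<in> I" for a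
      proof (rule le_funI)
        fix r show "x a r \<le> ?u r"
        proof (cases "r \<in> X interior_of F")
          case True
          then have "x a r = 0" using xJ a interior_of_subset by (fastforce simp: J0_def)
          then show ?thesis by simp
        next
          case False
          then show ?thesis using \<phi>(4) s(2)[OF a] s0 by (simp add: le_fun_def)
        qed
      qed
    qed
    then have "s t \<le> s t - min (s t) (s t * \<phi> t)" by (rule le_funD)
    then show ?thesis using \<phi>(2) s0[of t] by simp
  qed
  \<comment> \<open>Two continuous functions that agree on a set agree on its closure, which here is
    all of \<open>F\<close>.\<close>
  have "s t = 0" if "t \<in> F" for t
    using that zero C0_continuous[OF s(1)] F
    by (intro forall_in_closure_of_eq[of t X "X interior_of F" euclideanreal s "\<lambda>_. 0"]) auto
  then show "s \<in> J0 X F" using s(1) by (simp add: J0_def)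
qed

section \<open>Projection bands and clopen sets\<close>

text \<open>A bump supported off \<open>F\<close> lies in \<open>J0 X F\<close> and is 1 at
  \<open>t\<close>; disjointness from it forces \<open>h t = 0\<close>.\<close>

lemma disjoint_complement_J0_vanishes:
  assumes lc: "locally_compact_space X" and H: "Hausdorff_space X" and F: "closedin X F"
    and h: "h \<in> disjoint_complement (C0 X) (J0 X F)" and t: "t \<notin> F"
  shows "h t = 0"
proof (cases "t \<in> topspace X")
  case True
  then have "openin X (topspace X - F)" "t \<in> topspace X - F" using F t by auto
  then obtain \<phi> where \<phi>: "\<phi> \<in> C0 X" "\<phi> t = 1" "\<And>r. r \<notin> topspace X - F \<Longrightarrow> \<phi> r = 0"
    using C0_bump[OF lc H] by metis
  then have "\<phi> \<in> J0 X F" by (simp add: J0_def)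
  then have "min \<bar>h t\<bar> \<bar>\<phi> t\<bar> = 0" using h unfolding disjoint_complement_def by (auto dest: fun_cong)
  then show ?thesis using \<phi>(2) by (simp add: min_def split: if_splits)
qed (use h in \<open>auto simp: disjoint_complement_def C0_def\<close>)

lemma projection_band_J0_imp_openin:
  assumes lc: "locally_compact_space X" and H: "Hausdorff_space X" and F: "closedin X F"
    and P: "projection_band (C0 X) (J0 X F)"
  shows "openin X F"
proof (subst openin_subopen, intro ballI)
  fix t assume t: "t \<in> F"
  then have "t \<in> topspace X" using closedin_subset[OF F] by blast
  then obtain f where f: "f \<in> C0 X" "f t = 1" using C0_bump[OF lc H openin_topspace] by metis
  obtain g h where g: "g \<in> J0 X F" and h: "h \<in> disjoint_complement (C0 X) (J0 X F)"
      and fgh: "f = (\<lambda>t. g t + h t)"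
    using P f(1) unfolding projection_band_def by blast
  have hC: "h \<in> C0 X" using h by (simp add: disjoint_complement_def)
  have "openin X {r \<in> topspace X. h r \<in> - {0}}"
    using C0_continuous[OF hC] by (rule openin_continuous_map_preimage) auto
  \<comment> \<open>Since \<open>g\<close> vanishes on \<open>F\<close>, the whole value
    \<open>f t = 1\<close> comes from \<open>h\<close>.\<close>
  moreover have "h t \<noteq> 0" using f(2) fgh g t by (simp add: J0_def)
  moreover have "{r \<in> topspace X. h r \<in> - {0}} \<subseteq> F"
    using disjoint_complement_J0_vanishes[OF lc H F h] by auto
  ultimately show "\<exists>T. openin X T \<and> t \<in> T \<and> T \<subseteq> F"
    using \<open>t \<in> topspace X\<close> by (intro exI[of _ "{r \<in> topspace X. h r \<in> - {0}}"]) auto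
qed

lemma projection_band_J0:
  assumes lc: "locally_compact_space X" and H: "Hausdorff_space X"
    and F: "closedin X F" "openin X F"
  shows "projection_band (C0 X) (J0 X F)"
  unfolding projection_band_def
proof (intro conjI)
  let ?D = "disjoint_complement (C0 X) (J0 X F)"
  have "F = X closure_of (X interior_of F)"
    using F by (simp add: interior_of_openin closure_of_closedin)
  then show "band (C0 X) (J0 X F)" by (rule band_J0[OF lc H])
  show "C0 X = {(\<lambda>t. g t + h t) |g h. g \<in> J0 X F \<and> h \<in> ?D}"
  proof
    show "{(\<lambda>t. g t + h t) |g h. g \<in> J0 X F \<and> h \<in> ?D} \<subseteq> C0 X"
      by (auto simp: J0_def disjoint_complement_def C0_add)
    show "C0 X \<subseteq> {(\<lambda>t. g t + h t) |g h. g \<in> J0 X F \<and> h \<in> ?D}"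
    proof
      fix f assume f: "f \<in> C0 X"
      \<comment> \<open>Cutting \<open>f\<close> along the clopen set splits it: the part on
        \<open>F\<close> is disjoint from \<open>J0 X F\<close>, the rest vanishes on
        \<open>F\<close>.\<close>
      let ?h = "\<lambda>t. if t \<in> F then f t else 0"
      have h: "?h \<in> C0 X" by (rule C0_restrict_clopen[OF f F])
      have "(\<lambda>t. f t - ?h t) \<in> J0 X F" using C0_diff[OF f h] by (simp add: J0_def)
      moreover have "?h \<in> ?D" using h by (auto simp: disjoint_complement_def J0_def fun_eq_iff)
      moreover have "f = (\<lambda>t. (f t - ?h t) + ?h t)" by simp
      ultimately show "f \<in> {(\<lambda>t. g t + h t) |g h. g \<in> J0 X F \<and> h \<in> ?D}"
        by (intro CollectI exI conjI)
    qed
  qed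
  show "J0 X F \<inter> ?D = {\<lambda>t. 0}"
    using C0_zero by (fastforce simp: disjoint_complement_def J0_def fun_eq_iff)
qed

theorem theorem4p2:
  fixes X :: "'a topology" and J :: "('a \<Rightarrow> real) set"
  assumes "locally_compact_space X" and "Hausdorff_space X"
    and "order_ideal (C0 X) J" and "norm_closed_C0 X J"
  shows "(band (C0 X) J \<longleftrightarrow>
            (\<exists>F. closedin X F \<and> F = X closure_of (X interior_of F) \<and> J = J0 X F))
       \<and> (projection_band (C0 X) J \<longleftrightarrow>
            (\<exists>F. closedin X F \<and> openin X F \<and> J = J0 X F))"
proof -
  obtain F where F: "closedin X F" "J = J0 X F"
    using norm_closed_ideal_eq_J0[OF assms(3,4)] .
  let ?G = "X closure_of (X interior_of F)"
  \<comment> \<open>The open set \<open>X interior_of F\<close> lies in \<open>?G\<close>, hence in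
    its interior, which gives one inclusion; closedness of \<open>?G\<close> gives the
    other.\<close>
  have "?G = X closure_of (X interior_of ?G)"
    by (intro subset_antisym closure_of_mono interior_of_maximal closure_of_minimal
        interior_of_subset closure_of_subset interior_of_subset_topspace) auto
  then have "\<exists>F. closedin X F \<and> F = X closure_of (X interior_of F) \<and> J = J0 X F"
    if "band (C0 X) J"
    using band_J0_imp_eq[OF assms(1,2) F(1)] that F(2) closedin_closure_of by metis
  then show ?thesis
    using F band_J0[OF assms(1,2)] projection_band_J0[OF assms(1,2)]
      projection_band_J0_imp_openin[OF assms(1,2)] by blast
qed

end
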